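(* Let $A$ be the tridiagonal operator on $\ell^2$ with complex coefficients $(\alpha_k)_{k\ge1}$, $(\beta_k)_{k\ge0}$, $(\gamma_k)_{k\ge0}$ described in the context. If $A$ is bounded and there is a constant $C_1$ such that $$0<|\alpha_k|,\ |\gamma_k|\le C_1<\infty\quad\text{for all } k,$$ then for any $\lambda\in\Omega(A)$ there exists a subsequence of the Padé approximants $\pi_n(\lambda)=P_n(\lambda)/Q_n(\lambda)$ which converges to $\phi(\lambda)$ with a geometric rate; that is, there exist an infinite set $\Lambda\subset\mathbb{N}$ and constants $C>0$, $0<\rho<1$ such that $Q_n(\lambda)\ne0$ and $|\phi(\lambda)-P_n(\lambda)/Q_n(\lambda)|\le C\rho^n$ for all $n\in\Lambda$.
   Context: $\ell^2$ is the complex Hilbert space of square-summable sequences with orthonormal basis $\{g_n\}_{n\ge0}$. The operator $A$ is represented in this basis by $$A=\begin{pmatrix}\beta_0&\gamma_0&0&0&\cdots\\ \alpha_1&\beta_1&\gamma_1&0&\cdots\\ 0&\alpha_2&\beta_2&\gamma_2&\cdots\\ \vdots&\vdots&\ddots&\ddots&\ddots\end{pmatrix},$$ i.e. $Ag_0=\beta_0g_0+\alpha_1g_1$ and $Ag_n=\gamma_{n-1}g_{n-1}+\beta_ng_n+\alpha_{n+1}g_{n+1}$ for $n\ge1$, where $\alpha_k,\beta_k,\gamma_k$ are complex numbers with all $\alpha_k\ne0$ and $\gamma_k\neq0$. When bounded, $A$ is extended by continuity to all of $\ell^2$. $\Omega(A)=\mathbb{C}\setminus\sigma(A)$ is the resolvent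 set, $R(\lambda)=(\lambda I-A)^{-1}$ for $\lambda\in\Omega(A)$, and $\phi(\lambda)=(R(\lambda)g_0,g_0)$. Put $a_n=\alpha_n\gamma_{n-1}$ for $n\ge1$ and $b_n=\beta_n$ for $n\ge0$. The polynomials $Q_n,P_n$ in $\lambda$ are the solutions of the recurrence $a_ny_{n-1}+b_ny_n+y_{n+1}=\lambda y_n$ for $n\ge1$ with initial values $Q_0=1$, $Q_1=\lambda-b_0$ and $P_0=0$, $P_1=1$. (They are the denominators and numerators of the convergents of the continued fraction $\frac{1|}{|\lambda-b_0}-\frac{a_1|}{|\lambda-b_1}-\frac{a_2|}{|\lambda-b_2}-\cdots$, and $\pi_n=P_n/Q_n$ are the diagonal-type Padé approximants of $\phi$ at infinity.) *)

theory Defs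
  imports "HOL-Analysis.Analysis" "HOL-Computational_Algebra.Polynomial"
begin

typedef ell2 = "{x :: nat \<Rightarrow> complex. summable (\<lambda>n. (cmod (x n))\<^sup>2)}"
  morphisms coord Abs_ell2
  by (rule exI[of _ "\<lambda>_. 0"]) simp

setup_lifting type_definition_ell2

lemma summable_coord: "summable (\<lambda>n. (cmod (coord x n))\<^sup>2)"
  using coord by blast

lemma ell2_eqI: "(\<And>n. coord x n = coord y n) \<Longrightarrow> x = y"
  by (simp add: coord_inject[symmetric] fun_eq_iff)

lemma mult_le_sum_squares: "a * b \<le> a\<^sup>2 + b\<^sup>2" for a b :: real
proof -
  have "0 \<le> (a - b)\<^sup>2 + (a\<^sup>2 + b\<^sup>2)"
    by simp
  then show ?thesis
    by (simp add: power2_diff)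
qed

lemma cmod_add_sq_le: "(cmod (a + b))\<^sup>2 \<le> 2 * (cmod a)\<^sup>2 + 2 * (cmod b)\<^sup>2"
proof -
  have "(cmod (a + b))\<^sup>2 \<le> (cmod a + cmod b)\<^sup>2"
    by (intro power_mono norm_triangle_ineq) simp
  also have "\<dots> \<le> 2 * (cmod a)\<^sup>2 + 2 * (cmod b)\<^sup>2"
    using zero_le_power2[of "cmod a - cmod b"] by (simp add: power2_diff power2_sum)
  finally show ?thesis .
qed

lemma summable_ell2_mult:
  assumes "\<And>n. norm (f n :: 'a :: banach) \<le> cmod (coord x n) * cmod (coord y n)"
  shows "summable f"
proof (rule summable_comparison_test')
  show "summable (\<lambda>n. (cmod (coord x n))\<^sup>2 + (cmod (coord y n))\<^sup>2)"
    by (intro summable_add summable_coord)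
  show "norm (f n) \<le> (cmod (coord x n))\<^sup>2 + (cmod (coord y n))\<^sup>2" if "n \<ge> 0" for n
    using assms[of n] mult_le_sum_squares[of "cmod (coord x n)" "cmod (coord y n)"] by linarith
qed

lift_definition scaleC :: "complex \<Rightarrow> ell2 \<Rightarrow> ell2"  (infixr "*\<^sub>C" 75)
  is "\<lambda>c x n. c * x n"
  by (simp add: norm_mult power_mult_distrib summable_mult)

lift_definition basis_vec :: "nat \<Rightarrow> ell2"
  is "\<lambda>n k. if k = n then 1 else 0"
  by (rule summable_finite[of "{_}"]) auto

definition cinner :: "ell2 \<Rightarrow> ell2 \<Rightarrow> complex"
  where "cinner x y = (\<Sum>n. coord x n * cnj (coord y n))"

lemma summable_cinner: "summable (\<lambda>n. coord x n * cnj (coord y n))"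
  by (rule summable_ell2_mult[of _ x y]) (simp add: norm_mult)

instantiation ell2 :: real_vector
begin

lift_definition zero_ell2 :: ell2 is "\<lambda>_. 0"
  by simp

lift_definition plus_ell2 :: "ell2 \<Rightarrow> ell2 \<Rightarrow> ell2" is "\<lambda>x y n. x n + y n"
proof -
  fix x y :: "nat \<Rightarrow> complex"
  assume "summable (\<lambda>n. (cmod (x n))\<^sup>2)" and "summable (\<lambda>n. (cmod (y n))\<^sup>2)"
  then have "summable (\<lambda>n. 2 * (cmod (x n))\<^sup>2 + 2 * (cmod (y n))\<^sup>2)"
    by (intro summable_add summable_mult)
  then show "summable (\<lambda>n. (cmod (x n + y n))\<^sup>2)"
    by (rule summable_comparison_test') (simp add: cmod_add_sq_le)
qed

lift_definition uminus_ell2 :: "ell2 \<Rightarrow> ell2" is "\<lambda>x n. - x n"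
  by simp

definition minus_ell2 :: "ell2 \<Rightarrow> ell2 \<Rightarrow> ell2"
  where "x - y = x + - y" for x y :: ell2

definition scaleR_ell2 :: "real \<Rightarrow> ell2 \<Rightarrow> ell2"
  where "scaleR_ell2 r x = complex_of_real r *\<^sub>C x"

instance
proof
  note defs = minus_ell2_def scaleR_ell2_def plus_ell2.rep_eq zero_ell2.rep_eq
    uminus_ell2.rep_eq scaleC.rep_eq
  fix x y z :: ell2 and r s :: real
  show "x + y + z = x + (y + z)" "x + y = y + x" "0 + x = x" "- x + x = 0" "x - y = x + - y"
    "r *\<^sub>R (x + y) = r *\<^sub>R x + r *\<^sub>R y" "(r + s) *\<^sub>R x = r *\<^sub>R x + s *\<^sub>R x"
    "r *\<^sub>R s *\<^sub>R x = (r * s) *\<^sub>R x" "1 *\<^sub>R x = x"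
    by (auto intro!: ell2_eqI simp: defs algebra_simps)
qed

end

instantiation ell2 :: real_inner
begin

definition norm_ell2 :: "ell2 \<Rightarrow> real"
  where "norm_ell2 x = sqrt (\<Sum>n. (cmod (coord x n))\<^sup>2)"

definition inner_ell2 :: "ell2 \<Rightarrow> ell2 \<Rightarrow> real"
  where "inner_ell2 x y = Re (cinner x y)"

definition sgn_ell2 :: "ell2 \<Rightarrow> ell2"
  where "sgn_ell2 x = x /\<^sub>R norm x"

definition dist_ell2 :: "ell2 \<Rightarrow> ell2 \<Rightarrow> real"
  where "dist_ell2 x y = norm (x - y)"

definition uniformity_ell2 :: "(ell2 \<times> ell2) filter"
  where "uniformity_ell2 = (INF e\<in>{0 <..}. principal {(x, y). dist x y < e})"

definition open_ell2 :: "ell2 set \<Rightarrow> bool"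
  where "open_ell2 U = (\<forall>x\<in>U. eventually (\<lambda>(x', y). x' = x \<longrightarrow> y \<in> U) uniformity)"

instance
proof
  have inner_eq: "inner x y = (\<Sum>n. Re (coord x n * cnj (coord y n)))" for x y :: ell2
    by (simp add: inner_ell2_def cinner_def Re_suminf[OF summable_cinner])
  have sum_inner: "summable (\<lambda>n. Re (coord x n * cnj (coord y n)))" for x y :: ell2
    by (intro summable_Re summable_cinner)
  have inner_self: "inner x x = (\<Sum>n. (cmod (coord x n))\<^sup>2)" for x :: ell2
    unfolding inner_eq cmod_power2 by (simp add: power2_eq_square)
  note defs = scaleR_ell2_def plus_ell2.rep_eq zero_ell2.rep_eq
    scaleC.rep_eq
  fix x y z :: ell2 and r :: real
  show "sgn x = x /\<^sub>R norm x"
    by (rule sgn_ell2_def)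
  show "dist x y = norm (x - y)"
    by (rule dist_ell2_def)
  show "uniformity = (INF e\<in>{0 <..}. principal {(x :: ell2, y). dist x y < e})"
    by (rule uniformity_ell2_def)
  show "open U \<longleftrightarrow> (\<forall>x\<in>U. \<forall>\<^sub>F (x', y) in uniformity. x' = x \<longrightarrow> y \<in> U)" for U :: "ell2 set"
    by (rule open_ell2_def)
  show "inner x y = inner y x"
    unfolding inner_eq by (simp add: mult.commute)
  show "inner (x + y) z = inner x z + inner y z"
    unfolding inner_eq suminf_add[OF sum_inner sum_inner]
    by (simp add: defs algebra_simps)
  show "inner (r *\<^sub>R x) y = r * inner x y"
    unfolding inner_eq suminf_mult[OF sum_inner, symmetric]
    by (simp add: defs algebra_simps)
  show "0 \<le> inner x x"
    unfolding inner_self by (simp add: suminf_nonneg summable_coord)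
  show "inner x x = 0 \<longleftrightarrow> x = 0"
  proof
    assume "inner x x = 0"
    then have "\<forall>n. (cmod (coord x n))\<^sup>2 = 0"
      unfolding inner_self using suminf_eq_zero_iff[OF summable_coord[of x]] by simp
    then show "x = 0"
      by (intro ell2_eqI) (simp add: defs)
  qed (simp add: inner_self defs)
  show "norm x = sqrt (inner x x)"
    by (simp add: norm_ell2_def inner_self)
qed

end

definition bounded_operator :: "(ell2 \<Rightarrow> ell2) \<Rightarrow> bool"
  where "bounded_operator T \<longleftrightarrow> bounded_linear T \<and> (\<forall>c x. T (c *\<^sub>C x) = c *\<^sub>C T x)"

definition resolvent_set :: "(ell2 \<Rightarrow> ell2) \<Rightarrow> complex set"
  where "resolvent_set T = {z. bij (\<lambda>x. z *\<^sub>C x - T x) \<and> bounded_operator (inv (\<lambda>x. z *\<^sub>C x - T x))}"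

definition resolvent :: "(ell2 \<Rightarrow> ell2) \<Rightarrow> complex \<Rightarrow> ell2 \<Rightarrow> ell2"
  where "resolvent T z = inv (\<lambda>x. z *\<^sub>C x - T x)"

definition resolvent_function :: "(ell2 \<Rightarrow> ell2) \<Rightarrow> complex \<Rightarrow> complex"
  where "resolvent_function T z = cinner (resolvent T z (basis_vec 0)) (basis_vec 0)"

text \<open>The coefficient \<open>\<alpha> 0\<close> does not occur in the matrix. A bounded operator is determined by its
  values on the basis vectors: it is the continuous extension of its restriction to their span.\<close>

definition has_tridiagonal_matrix ::
    "(nat \<Rightarrow> complex) \<Rightarrow> (nat \<Rightarrow> complex) \<Rightarrow> (nat \<Rightarrow> complex) \<Rightarrow> (ell2 \<Rightarrow> ell2) \<Rightarrow> bool"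
  where "has_tridiagonal_matrix \<alpha> \<beta> \<gamma> T \<longleftrightarrow>
    T (basis_vec 0) = \<beta> 0 *\<^sub>C basis_vec 0 + \<alpha> 1 *\<^sub>C basis_vec 1 \<and>
    (\<forall>n\<ge>1. T (basis_vec n) =
      \<gamma> (n - 1) *\<^sub>C basis_vec (n - 1) + \<beta> n *\<^sub>C basis_vec n + \<alpha> (n + 1) *\<^sub>C basis_vec (n + 1))"

text \<open>The solution \<open>y\<close> of \<open>a\<^sub>n y\<^sub>n\<^sub>-\<^sub>1 + b\<^sub>n y\<^sub>n + y\<^sub>n\<^sub>+\<^sub>1 = \<lambda> y\<^sub>n\<close> for \<open>n \<ge> 1\<close> with given \<open>y\<^sub>0\<close> and \<open>y\<^sub>1\<close>,
  where \<open>[:0, 1:]\<close> is the indeterminate \<open>\<lambda>\<close>.\<close>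

fun three_term ::
    "(nat \<Rightarrow> complex) \<Rightarrow> (nat \<Rightarrow> complex) \<Rightarrow> complex poly \<Rightarrow> complex poly \<Rightarrow> nat \<Rightarrow> complex poly"
  where
    "three_term a b y0 y1 0 = y0"
  | "three_term a b y0 y1 (Suc 0) = y1"
  | "three_term a b y0 y1 (Suc (Suc n)) =
      [:0, 1:] * three_term a b y0 y1 (Suc n)
      - smult (b (Suc n)) (three_term a b y0 y1 (Suc n))
      - smult (a (Suc n)) (three_term a b y0 y1 n)"

definition pade_coeff :: "(nat \<Rightarrow> complex) \<Rightarrow> (nat \<Rightarrow> complex) \<Rightarrow> nat \<Rightarrow> complex"
  where "pade_coeff \<alpha> \<gamma> n = \<alpha> n * \<gamma> (n - 1)"

definition pade_denom ::
    "(nat \<Rightarrow> complex) \<Rightarrow> (nat \<Rightarrow> complex) \<Rightarrow> (nat \<Rightarrow> complex) \<Rightarrow> nat \<Rightarrow> complex poly"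
  where "pade_denom \<alpha> \<beta> \<gamma> = three_term (pade_coeff \<alpha> \<gamma>) \<beta> 1 [:- \<beta> 0, 1:]"

definition pade_numer ::
    "(nat \<Rightarrow> complex) \<Rightarrow> (nat \<Rightarrow> complex) \<Rightarrow> (nat \<Rightarrow> complex) \<Rightarrow> nat \<Rightarrow> complex poly"
  where "pade_numer \<alpha> \<beta> \<gamma> = three_term (pade_coeff \<alpha> \<gamma>) \<beta> 0 1"

lemma three_term_recurrence:
  assumes "n \<ge> 1" and "y = (\<lambda>k. poly (three_term a b y0 y1 k) z)"
  shows "a n * y (n - 1) + b n * y n + y (n + 1) = z * y n"
  using assms by (cases n) (auto simp: algebra_simps)

end

theory Submission
  imports Defs
begin

text \<open>Let \<open>x = R(z) g\<^sub>0\<close> and \<open>u\<^sub>n = Q\<^sub>n(z) / (\<gamma>\<^sub>0 \<dots> \<gamma>\<^sub>n\<^sub>-\<^sub>1)\<close>. Both solve the same three-term recurrence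
  away from the first row, which gives \<open>\<phi>(z) - P\<^sub>n(z) / Q\<^sub>n(z) = x\<^sub>n / u\<^sub>n\<close>.

  The numerators decay geometrically: applying \<open>z I - A\<close> to the tail of \<open>x\<close> from index \<open>n\<close> on leaves
  only two boundary entries, so the squared norms \<open>T\<^sub>n\<close> of the tails satisfy
  \<open>T\<^sub>n\<^sub>+\<^sub>1 \<le> K (T\<^sub>n - T\<^sub>n\<^sub>+\<^sub>2)\<close>, whence \<open>T\<^sub>n\<^sub>+\<^sub>2 \<le> K / (1 + K) T\<^sub>n\<close>.

  The denominators do not become small: \<open>y\<^sub>n = (R(z) g\<^sub>n, g\<^sub>0)\<close> solves the transposed recurrence, so
  the Wronskian \<open>\<gamma>\<^sub>n y\<^sub>n u\<^sub>n\<^sub>+\<^sub>1 - \<alpha>\<^sub>n\<^sub>+\<^sub>1 y\<^sub>n\<^sub>+\<^sub>1 u\<^sub>n\<close> is constantly \<open>1\<close>, and since \<open>y\<close> is bounded,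
  one of \<open>u\<^sub>n\<close>, \<open>u\<^sub>n\<^sub>+\<^sub>1\<close> is bounded away from zero.\<close>

section \<open>Coordinates and tails in the sequence space\<close>

lemma coord_add: "coord (x + y) n = coord x n + coord y n"
  by (simp add: plus_ell2.rep_eq)

lemma coord_diff: "coord (x - y) n = coord x n - coord y n"
  unfolding minus_ell2_def by (simp only: plus_ell2.rep_eq uminus_ell2.rep_eq) simp

lemma coord_scaleC: "coord (c *\<^sub>C x) n = c * coord x n"
  by (simp add: scaleC.rep_eq)

lemma coord_basis_vec: "coord (basis_vec n) k = (if k = n then 1 else 0)"
  by (simp add: basis_vec.rep_eq)

lemma coord_zero: "coord 0 n = 0"
  by (simp add: zero_ell2.rep_eq)

lemmas coord_simps = coord_add coord_diff coord_scaleC coord_basis_vec coord_zero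

lemma coord_sum: "coord (\<Sum>i\<in>I. f i) n = (\<Sum>i\<in>I. coord (f i) n)"
  by (induction I rule: infinite_finite_induct) (auto simp: coord_simps)

lemma norm_ell2_sq: "(norm x)\<^sup>2 = (\<Sum>n. (cmod (coord x n))\<^sup>2)"
  by (simp add: norm_ell2_def suminf_nonneg summable_coord)

lemma cmod_coord_le_norm: "cmod (coord x n) \<le> norm x"
proof (rule power2_le_imp_le)
  show "(cmod (coord x n))\<^sup>2 \<le> (norm x)\<^sup>2"
    using sum_le_suminf[OF summable_coord[of x], of "{n}"] by (simp add: norm_ell2_sq)
qed simp

lemma bounded_linear_coord: "bounded_linear (\<lambda>x. coord x n)"
proof (rule bounded_linear_intro)
  show "coord (r *\<^sub>R x) n = r *\<^sub>R coord x n" for r x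
    by (simp add: scaleR_ell2_def coord_scaleC scaleR_conv_of_real)
  show "norm (coord x n) \<le> norm x * 1" for x
    using cmod_coord_le_norm by simp
qed (simp add: coord_add)

lemma cinner_basis_vec: "cinner x (basis_vec n) = coord x n"
proof -
  have "cinner x (basis_vec n) = (\<Sum>k\<in>{n}. coord x k * cnj (coord (basis_vec n) k))"
    unfolding cinner_def by (rule suminf_finite) (auto simp: coord_basis_vec)
  then show ?thesis by (simp add: coord_basis_vec)
qed

lemma norm_scaleC: "norm (c *\<^sub>C x) = cmod c * norm x"
proof (rule power2_eq_imp_eq)
  show "(norm (c *\<^sub>C x))\<^sup>2 = (cmod c * norm x)\<^sup>2"
    by (simp add: norm_ell2_sq coord_scaleC norm_mult power_mult_distrib suminf_mult summable_coord)
qed auto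

lemma norm_basis_vec: "norm (basis_vec n) = 1"
proof -
  have "(norm (basis_vec n))\<^sup>2 = (\<Sum>k\<in>{n}. (cmod (coord (basis_vec n) k))\<^sup>2)"
    unfolding norm_ell2_sq by (rule suminf_finite) (auto simp: coord_basis_vec)
  then show ?thesis
    by (simp add: coord_basis_vec power2_eq_1_iff) (smt (verit) norm_ge_zero)
qed

text \<open>The entries keep their indices instead of being shifted down, so the operator itself can
  be applied to a tail.\<close>

lift_definition tail :: "nat \<Rightarrow> ell2 \<Rightarrow> ell2" is "\<lambda>n x k. if k < n then 0 else x k"
proof -
  fix n and x :: "nat \<Rightarrow> complex"
  assume "summable (\<lambda>k. (cmod (x k))\<^sup>2)"
  then show "summable (\<lambda>k. (cmod (if k < n then 0 else x k))\<^sup>2)"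
    by (rule summable_comparison_test') auto
qed

lemma coord_tail: "coord (tail n x) k = (if k < n then 0 else coord x k)"
  by (simp add: tail.rep_eq)

lemma norm_tail_sq: "(norm (tail n x))\<^sup>2 = (norm x)\<^sup>2 - (\<Sum>k<n. (cmod (coord x k))\<^sup>2)"
proof -
  have "(norm (tail n x))\<^sup>2 = (\<Sum>k. (cmod (coord (tail n x) (k + n)))\<^sup>2)"
    using suminf_split_initial_segment[OF summable_coord[of "tail n x"], of n]
    by (simp add: norm_ell2_sq coord_tail)
  also have "\<dots> = (\<Sum>k. (cmod (coord x (k + n)))\<^sup>2)"
    by (simp add: coord_tail)
  finally show ?thesis
    by (simp add: norm_ell2_sq suminf_minus_initial_segment[OF summable_coord])
qed

lemma tail_tendsto_0: "(\<lambda>n. tail n x) \<longlonglongrightarrow> 0"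
proof -
  have "(\<lambda>n. (norm x)\<^sup>2 - (\<Sum>k<n. (cmod (coord x k))\<^sup>2)) \<longlonglongrightarrow> (norm x)\<^sup>2 - (norm x)\<^sup>2"
    unfolding norm_ell2_sq by (intro tendsto_intros summable_LIMSEQ summable_coord)
  then have "(\<lambda>n. sqrt ((norm (tail n x))\<^sup>2)) \<longlonglongrightarrow> sqrt 0"
    unfolding norm_tail_sq by (intro tendsto_real_sqrt) simp
  then show ?thesis
    by (simp add: tendsto_norm_zero_iff)
qed

lemma tail_decomposition: "x = tail n x + (\<Sum>k<n. coord x k *\<^sub>C basis_vec k)"
proof (rule ell2_eqI)
  fix j
  have "(\<Sum>k<n. coord x k * (if j = k then 1 else 0)) = (if j < n then coord x j else 0)"
    by (simp add: if_distrib[of "\<lambda>t. _ * t"] cong: if_cong)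
  then show "coord x j = coord (tail n x + (\<Sum>k<n. coord x k *\<^sub>C basis_vec k)) j"
    by (simp add: coord_simps coord_sum coord_tail)
qed

text \<open>The difference of the maps vanishes on the finite part of
  \<open>tail_decomposition\<close>, so its value at \<open>x\<close> equals its value at every
  tail, and tails tend to 0. The scalar \<open>c\<close> in \<open>eq\<close> is there because the
  maps are only real-linear.\<close>

lemma bounded_linear_eq_on_basis:
  assumes f: "bounded_linear f" and g: "bounded_linear g"
    and eq: "\<And>c n. f (c *\<^sub>C basis_vec n) = g (c *\<^sub>C basis_vec n)"
  shows "f x = g x"
proof -
  interpret h: bounded_linear "\<lambda>x. f x - g x"
    using f g by (rule bounded_linear_sub)
  have "f (tail n x) - g (tail n x) = f x - g x" for n
  proof -
    have "f x - g x = (f (tail n x) - g (tail n x))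
        + (\<Sum>k<n. f (coord x k *\<^sub>C basis_vec k) - g (coord x k *\<^sub>C basis_vec k))"
      by (subst (1 2) tail_decomposition[of x n]) (simp only: h.add h.sum)
    then show ?thesis by (simp add: eq)
  qed
  moreover have "(\<lambda>n. f (tail n x) - g (tail n x)) \<longlonglongrightarrow> 0"
    by (rule h.tendsto_zero[OF tail_tendsto_0])
  ultimately show ?thesis
    by (simp add: LIMSEQ_const_iff)
qed

section \<open>The tridiagonal operator and its resolvent\<close>

text \<open>The matrix is given by its columns; the recurrences need its rows. Both sides are
  bounded linear in \<open>x\<close>, so basis vectors suffice. Row 0 is separate because
  \<open>j - 1\<close> truncates there.\<close>

lemma coord_tridiagonal:
  assumes tri: "has_tridiagonal_matrix \<alpha> \<beta> \<gamma> A" and A: "bounded_operator A"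
  shows "coord (A x) j =
    (if j = 0 then 0 else \<alpha> j * coord x (j - 1)) + \<beta> j * coord x j + \<gamma> j * coord x (j + 1)"
proof -
  have lin: "bounded_linear A" and scale: "A (c *\<^sub>C v) = c *\<^sub>C A v" for c v
    using A by (auto simp: bounded_operator_def)
  let ?g = "\<lambda>x. (if j = 0 then 0 else \<alpha> j * coord x (j - 1)) + \<beta> j * coord x j + \<gamma> j * coord x (j + 1)"
  have first: "bounded_linear (\<lambda>x. if j = 0 then 0 else \<alpha> j * coord x (j - 1))"
    by (cases "j = 0")
      (auto intro: bounded_linear_zero bounded_linear_compose[OF bounded_linear_mult_right bounded_linear_coord])
  have "coord (A (c *\<^sub>C basis_vec n)) j = ?g (c *\<^sub>C basis_vec n)" for c n
  proof (cases n)
    case 0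
    then have "A (basis_vec n) = \<beta> 0 *\<^sub>C basis_vec 0 + \<alpha> 1 *\<^sub>C basis_vec 1"
      using tri by (simp add: has_tridiagonal_matrix_def)
    with 0 show ?thesis
      by (cases "j = 0"; cases "j = 1") (auto simp: scale coord_simps)
  next
    case (Suc m)
    then have "A (basis_vec n) =
        \<gamma> (n - 1) *\<^sub>C basis_vec (n - 1) + \<beta> n *\<^sub>C basis_vec n + \<alpha> (n + 1) *\<^sub>C basis_vec (n + 1)"
      using tri by (simp add: has_tridiagonal_matrix_def)
    with Suc show ?thesis
      by (auto simp: scale coord_simps)
  qed
  moreover have "bounded_linear ?g"
    by (intro bounded_linear_add first bounded_linear_compose[OF bounded_linear_mult_right bounded_linear_coord])
  ultimately show ?thesis
    using bounded_linear_eq_on_basis[OF bounded_linear_compose[OF bounded_linear_coord lin], of ?g j x] by blast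
qed

text \<open>Cutting between \<open>n\<close> and \<open>Suc n\<close> severs only the two matrix
  entries coupling these indices. Rows below \<open>n\<close> see zeros, and rows above
  \<open>Suc n\<close> repeat the equation for \<open>x\<close>, whose right-hand side lives in row
  0.\<close>

lemma tridiagonal_shift_tail:
  assumes tri: "has_tridiagonal_matrix \<alpha> \<beta> \<gamma> A" and A: "bounded_operator A"
    and x: "z *\<^sub>C x - A x = basis_vec 0"
  shows "z *\<^sub>C tail (Suc n) x - A (tail (Suc n) x) =
    (\<alpha> (Suc n) * coord x n) *\<^sub>C basis_vec (Suc n) - (\<gamma> n * coord x (Suc n)) *\<^sub>C basis_vec n"
    (is "?l = ?r")
proof (rule ell2_eqI)
  fix j
  have row: "z * coord x i - coord (A x) i = (if i = 0 then 1 else 0)" for i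
    using arg_cong[OF x, of "\<lambda>v. coord v i"] by (simp add: coord_simps)
  consider "j < n" | "j = n" | "j = Suc n" | "j > Suc n"
    by linarith
  then show "coord ?l j = coord ?r j"
  proof cases
    case 4
    then show ?thesis
      using row[of j] by (simp add: coord_simps coord_tridiagonal[OF tri A] coord_tail)
  next
    case 3
    then show ?thesis
      using row[of j] by (simp add: coord_simps coord_tridiagonal[OF tri A] coord_tail algebra_simps)
  qed (auto simp: coord_simps coord_tridiagonal[OF tri A] coord_tail)
qed

lemma two_step_geometric_decay:
  fixes T :: "nat \<Rightarrow> real"
  assumes K: "K > 0" and nonneg: "\<And>n. 0 \<le> T n" and dec: "\<And>n. T (Suc n) \<le> T n"
    and le: "\<And>n. T (Suc n) \<le> K * (T n - T (Suc (Suc n)))"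
  shows "\<exists>C s. C \<ge> 0 \<and> 0 < s \<and> s < 1 \<and> (\<forall>n. T n \<le> C * s ^ n)"
proof -
  define q where "q = K / (1 + K)"
  have q: "0 < q" "q < 1"
    using K by (auto simp: q_def field_simps)
  have step: "T (Suc (Suc n)) \<le> q * T n" for n
  proof -
    \<comment> \<open>Monotonicity bounds \<open>T (Suc (Suc n))\<close> by
      \<open>T (Suc n)\<close>; \<open>le\<close> then lets the negative term move to the
      left.\<close>
    have "(1 + K) * T (Suc (Suc n)) \<le> K * T n"
      using dec[of "Suc n"] le[of n] by (simp add: algebra_simps)
    then show ?thesis
      using K by (simp add: q_def field_simps)
  qed
  define s where "s = sqrt q"
  have s: "0 < s" "s < 1" "s * s = q"
    using q by (auto simp: s_def)
  \<comment> \<open>Dividing by \<open>s\<close> covers index 1, where only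
    \<open>T 1 \<le> T 0\<close> is available.\<close>
  define C where "C = T 0 / s"
  have C: "C * s = T 0" "0 \<le> C"
    using s nonneg[of 0] by (auto simp: C_def)
  have "T n \<le> C * s ^ n" for n
  proof (induction n rule: induct_nat_012)
    case 0
    show ?case
      using C s mult_left_le[of s C] by simp
  next
    case 1
    show ?case
      using C dec[of 0] by simp
  next
    case (ge2 n)
    have "T (Suc (Suc n)) \<le> q * (C * s ^ n)"
      using step[of n] mult_left_mono[OF ge2(1), of q] q by linarith
    also have "\<dots> = C * s ^ Suc (Suc n)"
      by (simp flip: s(3))
    finally show ?case .
  qed
  then show ?thesis
    using C s by blast
qed

text \<open>The resolvent enters only through the lower bound \<open>B\<close> for
  \<open>z I - A\<close>. Applied to a tail, it controls the tail by the two entries at the cut,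
  which are exactly what the squared norm loses over two steps.\<close>

lemma resolvent_column_decay:
  assumes tri: "has_tridiagonal_matrix \<alpha> \<beta> \<gamma> A" and A: "bounded_operator A"
    and \<alpha>: "\<And>k. k \<ge> 1 \<Longrightarrow> cmod (\<alpha> k) \<le> D" and \<gamma>: "\<And>k. cmod (\<gamma> k) \<le> D" and D: "D > 0"
    and x: "z *\<^sub>C x - A x = basis_vec 0"
    and B: "B > 0" "\<And>v. norm v \<le> B * norm (z *\<^sub>C v - A v)"
  shows "\<exists>C s. C \<ge> 0 \<and> 0 < s \<and> s < 1 \<and> (\<forall>n. cmod (coord x n) \<le> C * s ^ n)"
proof -
  define T where "T n = (norm (tail n x))\<^sup>2" for n
  define K where "K = 2 * (B * D)\<^sup>2"
  have T_Suc: "T (Suc n) = T n - (cmod (coord x n))\<^sup>2" for n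
    by (simp add: T_def norm_tail_sq)
  have le: "T (Suc n) \<le> K * (T n - T (Suc (Suc n)))" for n
  proof -
    let ?a = "cmod (coord x n)" and ?b = "cmod (coord x (Suc n))"
    have "norm (z *\<^sub>C tail (Suc n) x - A (tail (Suc n) x)) \<le>
        cmod (\<alpha> (Suc n)) * ?a + cmod (\<gamma> n) * ?b"
      unfolding tridiagonal_shift_tail[OF tri A x]
      by (rule order_trans[OF norm_triangle_ineq4]) (simp add: norm_scaleC norm_basis_vec norm_mult)
    also have "\<dots> \<le> D * ?a + D * ?b"
      using \<alpha>[of "Suc n"] \<gamma>[of n] by (intro add_mono mult_right_mono) auto
    finally have "norm (tail (Suc n) x) \<le> B * (D * ?a + D * ?b)"
      using B(2)[of "tail (Suc n) x"] mult_left_mono[of _ "D * ?a + D * ?b" B] B(1)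
      by (meson less_imp_le order_trans)
    then have "T (Suc n) \<le> (B * (D * ?a + D * ?b))\<^sup>2"
      unfolding T_def by (intro power_mono) auto
    also have "\<dots> = (B * D)\<^sup>2 * (?a + ?b)\<^sup>2"
      by (simp add: power2_eq_square algebra_simps)
    \<comment> \<open>This is the source of the factor 2 in \<open>K\<close>.\<close>
    also have "\<dots> \<le> (B * D)\<^sup>2 * (2 * (?a\<^sup>2 + ?b\<^sup>2))"
      using zero_le_power2[of "?a - ?b"]
      by (intro mult_left_mono) (simp_all add: power2_diff power2_sum)
    also have "\<dots> = K * (T n - T (Suc (Suc n)))"
      by (simp add: K_def T_Suc)
    finally show ?thesis .
  qed
  obtain C s where C: "C \<ge> 0" and s: "0 < s" "s < 1" and T: "\<And>n. T n \<le> C * s ^ n"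
    using two_step_geometric_decay[of K T] le B(1) D
    by (auto simp: K_def T_Suc) (auto simp: T_def)
  have "cmod (coord x n) \<le> sqrt C * sqrt s ^ n" for n
  proof -
    have "(cmod (coord x n))\<^sup>2 \<le> T n"
      using cmod_coord_le_norm[of "tail n x" n] by (simp add: T_def coord_tail)
    then have "cmod (coord x n) \<le> sqrt (C * s ^ n)"
      using T[of n] by (intro real_le_rsqrt) linarith
    then show ?thesis
      by (simp add: real_sqrt_mult real_sqrt_power)
  qed
  then show ?thesis
    using C s by (intro exI[of _ "sqrt C"] exI[of _ "sqrt s"]) auto
qed

section \<open>Convergence\<close>

lemma poly_pade_denom:
  "poly (pade_denom \<alpha> \<beta> \<gamma> 0) z = 1"
  "poly (pade_denom \<alpha> \<beta> \<gamma> (Suc 0)) z = z - \<beta> 0"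
  "poly (pade_denom \<alpha> \<beta> \<gamma> (Suc (Suc n))) z =
    (z - \<beta> (Suc n)) * poly (pade_denom \<alpha> \<beta> \<gamma> (Suc n)) z
    - \<alpha> (Suc n) * \<gamma> n * poly (pade_denom \<alpha> \<beta> \<gamma> n) z"
  by (simp_all add: pade_denom_def pade_coeff_def algebra_simps)

lemma poly_pade_numer:
  "poly (pade_numer \<alpha> \<beta> \<gamma> 0) z = 0"
  "poly (pade_numer \<alpha> \<beta> \<gamma> (Suc 0)) z = 1"
  "poly (pade_numer \<alpha> \<beta> \<gamma> (Suc (Suc n))) z =
    (z - \<beta> (Suc n)) * poly (pade_numer \<alpha> \<beta> \<gamma> (Suc n)) z
    - \<alpha> (Suc n) * \<gamma> n * poly (pade_numer \<alpha> \<beta> \<gamma> n) z"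
  by (simp_all add: pade_numer_def pade_coeff_def algebra_simps)

text \<open>Multiplying \<open>x n\<close> by the product of the first \<open>n\<close> values of
  \<gamma> turns the row equations into the recurrence of the Pade polynomials; the two sides then
  agree by their initial values.\<close>

lemma pade_remainder:
  assumes "(z - \<beta> 0) * x 0 - \<gamma> 0 * x 1 = 1"
    and "\<And>n. (z - \<beta> (Suc n)) * x (Suc n) - \<alpha> (Suc n) * x n - \<gamma> (Suc n) * x (Suc (Suc n)) = 0"
  shows "x n * (\<Prod>i<n. \<gamma> i) = x 0 * poly (pade_denom \<alpha> \<beta> \<gamma> n) z - poly (pade_numer \<alpha> \<beta> \<gamma> n) z"
proof (induction n rule: induct_nat_012)
  case 0
  show ?case by (simp add: poly_pade_denom poly_pade_numer)
next
  case 1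
  show ?case using assms(1) by (simp add: poly_pade_denom poly_pade_numer algebra_simps)
next
  case (ge2 n)
  have "x (Suc (Suc n)) * (\<Prod>i<Suc (Suc n). \<gamma> i) =
      (\<gamma> (Suc n) * x (Suc (Suc n))) * (\<Prod>i<Suc n. \<gamma> i)"
    by simp
  also have "\<gamma> (Suc n) * x (Suc (Suc n)) = (z - \<beta> (Suc n)) * x (Suc n) - \<alpha> (Suc n) * x n"
    using assms(2)[of n] by simp
  also have "\<dots> * (\<Prod>i<Suc n. \<gamma> i) = (z - \<beta> (Suc n)) * (x (Suc n) * (\<Prod>i<Suc n. \<gamma> i))
      - \<alpha> (Suc n) * \<gamma> n * (x n * (\<Prod>i<n. \<gamma> i))"
    by (simp add: algebra_simps)
  finally show ?case
    unfolding ge2 by (simp add: poly_pade_denom poly_pade_numer algebra_simps)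
qed

text \<open>After substituting both recurrences the \<open>b\<close> terms cancel, leaving the
  previous Wronskian. The initial equation for \<open>y\<close> fixes its value.\<close>

lemma wronskian_eq_1:
  fixes u y :: "nat \<Rightarrow> 'a::comm_ring_1"
  assumes "\<gamma> 0 * u 1 = b 0 * u 0" and "u 0 = 1" and "b 0 * y 0 - \<alpha> 1 * y 1 = 1"
    and u: "\<And>n. \<gamma> (Suc n) * u (Suc (Suc n)) = b (Suc n) * u (Suc n) - \<alpha> (Suc n) * u n"
    and y: "\<And>n. \<alpha> (Suc (Suc n)) * y (Suc (Suc n)) = b (Suc n) * y (Suc n) - \<gamma> n * y n"
  shows "\<gamma> n * u (Suc n) * y n - \<alpha> (Suc n) * y (Suc n) * u n = 1"
proof (induction n)
  case 0
  show ?case using assms(1-3) by simp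
next
  case (Suc n)
  show ?case unfolding u y using Suc by (simp add: algebra_simps)
qed

theorem theorem2:
  fixes \<alpha> \<beta> \<gamma> :: "nat \<Rightarrow> complex" and A :: "ell2 \<Rightarrow> ell2" and C\<^sub>1 :: real and z :: complex
  assumes "has_tridiagonal_matrix \<alpha> \<beta> \<gamma> A"
    and "bounded_operator A"
    and "\<And>k. k \<ge> 1 \<Longrightarrow> 0 < cmod (\<alpha> k) \<and> cmod (\<alpha> k) \<le> C\<^sub>1"
    and "\<And>k. 0 < cmod (\<gamma> k) \<and> cmod (\<gamma> k) \<le> C\<^sub>1"
    and "z \<in> resolvent_set A"
  shows "\<exists>(\<Lambda> :: nat set) (C :: real) (\<rho> :: real).
    infinite \<Lambda> \<and> C > 0 \<and> 0 < \<rho> \<and> \<rho> < 1 \<and>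
    (\<forall>n\<in>\<Lambda>. poly (pade_denom \<alpha> \<beta> \<gamma> n) z \<noteq> 0 \<and>
      cmod (resolvent_function A z - poly (pade_numer \<alpha> \<beta> \<gamma> n) z / poly (pade_denom \<alpha> \<beta> \<gamma> n) z)
        \<le> C * \<rho> ^ n)"
proof -
  note tri = assms(1) and A = assms(2)
  have \<alpha>: "cmod (\<alpha> k) \<le> C\<^sub>1" if "k \<ge> 1" for k
    using assms(3) that by blast
  have \<gamma>: "cmod (\<gamma> k) \<le> C\<^sub>1" "\<gamma> k \<noteq> 0" for k
    using assms(4)[of k] by auto
  have C1: "C\<^sub>1 > 0"
    using assms(4)[of 0] by linarith
  define L where "L v = z *\<^sub>C v - A v" for v
  define M where "M = resolvent A z"
  have bij: "bij L" and M: "M = inv L" and M_op: "bounded_operator M"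
    using assms(5) by (auto simp: resolvent_set_def resolvent_def M_def L_def[abs_def])
  have shift_resolvent: "L (M v) = v" and resolvent_shift: "M (L v) = v" for v
    using bij by (auto simp: M bij_def surj_f_inv_f)
  interpret M: bounded_linear M
    using M_op by (simp add: bounded_operator_def)
  have M_scale: "M (c *\<^sub>C v) = c *\<^sub>C M v" for c v
    using M_op by (simp add: bounded_operator_def)
  obtain B where B: "B > 0" "\<And>v. norm (M v) \<le> norm v * B"
    using M.pos_bounded by blast

  define x where "x = M (basis_vec 0)"
  have x: "z *\<^sub>C x - A x = basis_vec 0"
    using shift_resolvent[of "basis_vec 0"] by (simp add: L_def x_def)
  \<comment> \<open>Boundedness of the resolvent, read at \<open>L v\<close>, is the lower bound for
    \<open>z I - A\<close>.\<close>
  have "norm v \<le> B * norm (z *\<^sub>C v - A v)" for v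
    using B(2)[of "L v"] by (simp add: resolvent_shift L_def[symmetric] mult.commute)
  from resolvent_column_decay[OF tri A \<alpha> \<gamma>(1) C1 x B(1) this] obtain C s
    where C: "C \<ge> 0" and s: "0 < s" "s < 1" and decay: "\<And>n. cmod (coord x n) \<le> C * s ^ n"
    by auto
  have row: "z * coord x i - coord (A x) i = (if i = 0 then 1 else 0)" for i
    using arg_cong[OF x, of "\<lambda>v. coord v i"] by (simp add: coord_simps)

  define P where "P n = poly (pade_numer \<alpha> \<beta> \<gamma> n) z" for n
  define Q where "Q n = poly (pade_denom \<alpha> \<beta> \<gamma> n) z" for n
  \<comment> \<open>This scaling turns the monic recurrence of \<open>Q\<close> back into the rows
    of \<open>z I - A\<close>.\<close>
  define u where "u n = Q n / (\<Prod>i<n. \<gamma> i)" for n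
  have prod_nz: "(\<Prod>i<n. \<gamma> i) \<noteq> 0" for n
    using \<gamma>(2) by simp
  have remainder: "coord x n * (\<Prod>i<n. \<gamma> i) = coord x 0 * Q n - P n" for n
    unfolding P_def Q_def
  proof (rule pade_remainder)
    show "(z - \<beta> 0) * coord x 0 - \<gamma> 0 * coord x 1 = 1"
      using row[of 0] by (simp add: coord_tridiagonal[OF tri A] algebra_simps)
    show "(z - \<beta> (Suc n)) * coord x (Suc n) - \<alpha> (Suc n) * coord x n
        - \<gamma> (Suc n) * coord x (Suc (Suc n)) = 0" for n
      using row[of "Suc n"] by (simp add: coord_tridiagonal[OF tri A] algebra_simps)
  qed

  \<comment> \<open>Row 0 of the resolvent. Its recurrence comes from \<open>M (L v) = v\<close> on
    basis vectors, whereas that of the column \<open>x\<close> came from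
    \<open>L (M v) = v\<close>.\<close>
  define y where "y n = coord (M (basis_vec n)) 0" for n
  have y_bound: "cmod (y n) \<le> B" for n
    using cmod_coord_le_norm[of "M (basis_vec n)" 0] B(2)[of "basis_vec n"]
    by (simp add: y_def norm_basis_vec)
  have "y 0 * (z - \<beta> 0) - \<alpha> 1 * y 1 = 1"
  proof -
    have "L (basis_vec 0) = (z - \<beta> 0) *\<^sub>C basis_vec 0 - \<alpha> 1 *\<^sub>C basis_vec 1"
      using tri by (auto intro!: ell2_eqI simp: L_def has_tridiagonal_matrix_def coord_simps algebra_simps)
    then have "coord (M (L (basis_vec 0))) 0 = (z - \<beta> 0) * y 0 - \<alpha> 1 * y 1"
      by (simp add: M.diff M_scale coord_simps y_def)
    then show ?thesis by (simp add: resolvent_shift coord_simps mult.commute)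
  qed
  moreover have "\<alpha> (Suc (Suc n)) * y (Suc (Suc n)) = (z - \<beta> (Suc n)) * y (Suc n) - \<gamma> n * y n" for n
  proof -
    have "L (basis_vec (Suc n)) = (z - \<beta> (Suc n)) *\<^sub>C basis_vec (Suc n) - \<gamma> n *\<^sub>C basis_vec n
        - \<alpha> (Suc (Suc n)) *\<^sub>C basis_vec (Suc (Suc n))"
      using tri by (auto intro!: ell2_eqI simp: L_def has_tridiagonal_matrix_def coord_simps algebra_simps)
    then have "coord (M (L (basis_vec (Suc n)))) 0 =
        (z - \<beta> (Suc n)) * y (Suc n) - \<gamma> n * y n - \<alpha> (Suc (Suc n)) * y (Suc (Suc n))"
      by (simp add: M.diff M_scale coord_simps y_def)
    then show ?thesis by (simp add: resolvent_shift coord_simps)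
  qed
  moreover have "\<gamma> (Suc n) * u (Suc (Suc n)) = (z - \<beta> (Suc n)) * u (Suc n) - \<alpha> (Suc n) * u n" for n
    using \<gamma>(2) prod_nz[of n] by (simp add: u_def Q_def poly_pade_denom field_simps)
  moreover have "\<gamma> 0 * u 1 = (z - \<beta> 0) * u 0" "u 0 = 1"
    using \<gamma>(2)[of 0] by (simp_all add: u_def Q_def poly_pade_denom)
  ultimately have wronskian: "\<gamma> n * u (Suc n) * y n - \<alpha> (Suc n) * y (Suc n) * u n = 1" for n
    by (intro wronskian_eq_1[where b = "\<lambda>n. z - \<beta> n"]) (simp_all add: mult.commute)

  \<comment> \<open>Chosen so that two consecutive values of \<open>u\<close> below \<open>c\<close>
    would make the Wronskian smaller than 1 in modulus.\<close>
  define c where "c = 1 / (2 * (C\<^sub>1 * B))"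
  have c: "c > 0"
    using C1 B by (simp add: c_def)
  define \<Lambda> where "\<Lambda> = {n. cmod (u n) \<ge> c}"
  have "n \<in> \<Lambda> \<or> Suc n \<in> \<Lambda>" for n
  proof (rule ccontr)
    assume "\<not> ?thesis"
    then have lt: "cmod (u n) < c" "cmod (u (Suc n)) < c"
      by (auto simp: \<Lambda>_def)
    have "1 = cmod (\<gamma> n * u (Suc n) * y n - \<alpha> (Suc n) * y (Suc n) * u n)"
      by (simp add: wronskian)
    also have "\<dots> \<le> cmod (\<gamma> n) * cmod (y n) * cmod (u (Suc n))
        + cmod (\<alpha> (Suc n)) * cmod (y (Suc n)) * cmod (u n)"
      by (rule order_trans[OF norm_triangle_ineq4]) (simp add: norm_mult mult_ac)
    also have "\<dots> \<le> C\<^sub>1 * B * cmod (u (Suc n)) + C\<^sub>1 * B * cmod (u n)"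
      using \<alpha>[of "Suc n"] \<gamma>(1)[of n] y_bound C1 B(1)
      by (intro add_mono mult_right_mono mult_mono) auto
    also have "\<dots> < C\<^sub>1 * B * c + C\<^sub>1 * B * c"
      using lt C1 B(1) by (intro add_strict_mono mult_strict_left_mono) auto
    also have "\<dots> = 1"
      using C1 B(1) by (simp add: c_def)
    finally show False by simp
  qed
  \<comment> \<open>One of any two consecutive indices is good, so good indices are
    unbounded.\<close>
  then have "infinite \<Lambda>"
    unfolding infinite_nat_iff_unbounded_le by (meson le_Suc_eq order_refl)
  \<comment> \<open>The summand 1 makes the constant positive, since only \<open>C \<ge> 0\<close>
    is known.\<close>
  moreover have "Q n \<noteq> 0 \<and> cmod (resolvent_function A z - P n / Q n) \<le> (C / c + 1) * s ^ n"
    if "n \<in> \<Lambda>" for n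
  proof -
    have un: "cmod (u n) \<ge> c"
      using that by (simp add: \<Lambda>_def)
    then have "Q n \<noteq> 0"
      using c by (auto simp: u_def)
    moreover have "resolvent_function A z = coord x 0"
      by (simp add: resolvent_function_def cinner_basis_vec x_def M_def)
    ultimately have "resolvent_function A z - P n / Q n = coord x n / u n"
      using remainder[of n] prod_nz[of n] by (simp add: u_def field_simps)
    then have "cmod (resolvent_function A z - P n / Q n) = cmod (coord x n) / cmod (u n)"
      by (simp add: norm_divide)
    also have "\<dots> \<le> (C * s ^ n) / c"
      using decay[of n] un c C s by (intro frac_le) auto
    also have "\<dots> \<le> (C / c + 1) * s ^ n"
      using s by (simp add: algebra_simps)
    finally show ?thesis
      using \<open>Q n \<noteq> 0\<close> by blast
  qed
  moreover have "C / c + 1 > 0"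
    using C c by (simp add: add_nonneg_pos)
  ultimately show ?thesis
    using s unfolding P_def Q_def by blast
qed

end
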